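(* Let $K\subset\mathbb{C}$ be a closed convex body whose boundary is a twice differentiable curve with unit speed counter-clockwise parametrization $z:\mathbb{R}\to\mathbb{C}$. Let $c(t)$ be a smooth trajectory in $\Omega=\mathbb{C}\setminus K$, defined for $t$ near $0$, and let $\Pi(t)$ be the point of $K$ nearest to $c(t)$. Then the one-sided derivative $$\Pi_+'(0)=\lim_{t\searrow0}\frac{\Pi(t)-\Pi(0)}{t}$$ exists and $$|\Pi_+'(0)|=\frac{|\dot c_{\|}|}{1+r\,|z''|},$$ where $r>0$ is the distance from $c(0)$ to $K$, $z''$ is evaluated at the parameter $s_0$ with $z(s_0)=\Pi(0)$, and $\dot c_{\|}$ is the component of $\dot c(0)$ parallel to $z'(s_0)$.
   Context: $\mathbb{R}^2$ is identified with $\mathbb{C}$. A closed convex body is a closed convex set with nonempty interior. Unit speed means $|z'(s)|=1$ for all $s$; counter-clockwise means that $iz'(s)$ points into $K$. A dot denotes the derivative with respect to time $t$ and an accent denotes the derivative with respect to the boundary parameter $s$. The component of $\dot c$ parallel to $z'$ is its orthogonal projection onto the real line spanned by $z'$. *)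

theory Defs
  imports "HOL-Analysis.Analysis"
begin

(* Infinite differentiability. Derivatives are two-sided, so the notion is the usual one
   only for open S. *)
definition smooth_on :: "real set \<Rightarrow> (real \<Rightarrow> 'a::real_normed_vector) \<Rightarrow> bool" where
  "smooth_on S f \<longleftrightarrow>
     (\<forall>n. \<forall>t\<in>S. ((\<lambda>g u. vector_derivative g (at u)) ^^ n) f differentiable (at t))"

definition orth_proj :: "'a::euclidean_space set \<Rightarrow> 'a \<Rightarrow> 'a" where
  "orth_proj S v = (THE p. p \<in> S \<and> (\<forall>x\<in>S. orthogonal (v - p) x))"

lemma orth_proj_span_singleton:
  fixes v w :: "'a::euclidean_space"
  shows "orth_proj (span {w}) v = ((v \<bullet> w) / (w \<bullet> w)) *\<^sub>R w"
proof -
  define q where "q = ((v \<bullet> w) / (w \<bullet> w)) *\<^sub>R w"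
  have q: "q \<in> span {w}" "orthogonal (v - q) x" if "x \<in> span {w}" for x
    using that by (auto simp: q_def span_singleton orthogonal_def inner_diff_left)
  have "p = q" if p: "p \<in> span {w}" "\<forall>x\<in>span {w}. orthogonal (v - p) x" for p
  proof -
    have d: "p - q \<in> span {w}"
      using p q span_diff by blast
    then have "(v - q) \<bullet> (p - q) - (v - p) \<bullet> (p - q) = 0"
      using p q by (simp add: orthogonal_def)
    then have "(p - q) \<bullet> (p - q) = 0"
      by (simp add: inner_diff_left)
    then show ?thesis by simp
  qed
  then show ?thesis
    unfolding orth_proj_def q_def[symmetric] using q span_zero by (intro the_equality) blast+
qed

end

theory Submission
  imports Defs
begin

text \<open>Write \<open>N u = - \<i> z'(u)\<close>. Convexity makes \<open>N u\<close> the outer normal of \<open>K\<close> at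
  \<open>z u\<close>, so \<open>z u\<close> is the point of \<open>K\<close> nearest to \<open>x\<close> as soon as \<open>x - z u\<close> is a nonnegative
  multiple of \<open>N u\<close>. For points \<open>x\<close> near \<open>c 0\<close> and parameters \<open>u\<close> near the foot parameter \<open>s\<close>
  the sign of the multiple is automatic, and what remains is the single scalar equation
  \<open>(x - z u) \<bullet> z'(u) = 0\<close>.

  The body lies to the left of its tangents, so the curve turns left: \<open>z''\<close> is a nonnegative
  multiple of \<open>\<i> z'\<close> (\<open>curvature_vector\<close>). Since \<open>c 0 - z s = r N s\<close>, it follows that along the
  line \<open>u = s + b t\<close> the function \<open>(c t - z u) \<bullet> z'(u)\<close> vanishes at \<open>t = 0\<close> and has derivative
  \<open>c' \<bullet> z'(s) - b (1 + r |z''(s)|)\<close> there (\<open>tangential_offset_derivative\<close>). This is zero exactly for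
  the claimed speed \<open>b = a\<close>, with \<open>a = (c' \<bullet> z'(s)) / (1 + r |z''(s)|)\<close>, and it has opposite signs
  for \<open>b = a - \<epsilon>\<close> and \<open>b = a + \<epsilon>\<close>. Hence for small \<open>t > 0\<close> the intermediate value theorem puts a
  solution \<open>u\<close> between \<open>s + (a - \<epsilon>) t\<close> and \<open>s + (a + \<epsilon>) t\<close>, and \<open>z u\<close> is the
  projection of \<open>c t\<close>. By unit speed the projection stays within \<open>\<epsilon> t\<close> of \<open>z (s + a t)\<close>
  (\<open>closest_point_tracks_curve\<close>), so both have the same one-sided derivative \<open>a z'(s)\<close>.

  Since \<open>z''\<close> may be discontinuous, the implicit function theorem does not apply to the scalar
  equation; the comparison with the two lines through \<open>(0, s)\<close> in the \<open>(t, u)\<close>-plane takes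
  its place.\<close>

section \<open>Difference quotients and coordinates in a moving frame\<close>

lemma has_vector_derivative_quotient:
  fixes f :: "real \<Rightarrow> 'a::real_normed_vector"
  assumes "(f has_vector_derivative d) (at x)"
  shows "((\<lambda>h. (f (x + h) - f x) /\<^sub>R h) \<longlongrightarrow> d) (at 0)"
proof -
  have "((\<lambda>h. norm (f (x + h) - f x - h *\<^sub>R d) / norm h) \<longlongrightarrow> 0) (at 0)"
    using assms by (simp add: has_vector_derivative_def has_derivative_at)
  moreover have "norm (f (x + h) - f x - h *\<^sub>R d) / norm h = norm ((f (x + h) - f x) /\<^sub>R h - d)"
    if "h \<noteq> 0" for h
  proof -
    have "(f (x + h) - f x) /\<^sub>R h - d = (f (x + h) - f x - h *\<^sub>R d) /\<^sub>R h"
      using that by (simp add: scaleR_diff_right)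
    then show ?thesis
      by (simp add: divide_inverse mult.commute)
  qed
  ultimately have "((\<lambda>h. norm ((f (x + h) - f x) /\<^sub>R h - d)) \<longlongrightarrow> 0) (at 0)"
    by (elim Lim_transform_eventually) (simp add: eventually_at_filter)
  then show ?thesis
    by (simp add: tendsto_norm_zero_iff LIM_zero_iff)
qed

lemma complex_unit_frame:
  fixes T v :: complex
  assumes "norm T = 1"
  shows "v = (v \<bullet> T) *\<^sub>R T + (v \<bullet> (\<i> * T)) *\<^sub>R (\<i> * T)"
proof -
  have "(Re T)\<^sup>2 + (Im T)\<^sup>2 = 1"
    using assms by (simp add: cmod_def)
  then have "Re v = Re v * ((Re T)\<^sup>2 + (Im T)\<^sup>2)" "Im v = Im v * ((Re T)\<^sup>2 + (Im T)\<^sup>2)"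
    by simp_all
  then show ?thesis
    by (simp add: complex_eq_iff inner_complex_def power2_eq_square algebra_simps)
qed

section \<open>Convex bodies bounded by a unit speed curve\<close>

locale convex_body_boundary_curve =
  fixes K :: "complex set" and z z' z'' :: "real \<Rightarrow> complex"
  assumes K_closed: "closed K"
    and K_convex: "convex K"
    and K_body: "interior K \<noteq> {}"
    and z_boundary: "range z = frontier K"
    and z_deriv: "(z has_vector_derivative z' s) (at s)"
    and z_deriv2: "(z' has_vector_derivative z'' s) (at s)"
    and z_unit_speed: "norm (z' s) = 1"
    and z_ccw: "\<forall>\<^sub>F h in at_right 0. z s + h *\<^sub>R (\<i> * z' s) \<in> K"
begin

lemma curve_in_body: "z s \<in> K"
  using z_boundary frontier_subset_closed[OF K_closed] by blast

lemma body_nonempty: "K \<noteq> {}"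
  using curve_in_body by blast

lemma tangent_inner_self: "z' s \<bullet> z' s = 1"
  using z_unit_speed[of s] by (simp add: dot_square_norm)

lemma continuous_on_curve: "continuous_on S z" "continuous_on S z'"
  using z_deriv z_deriv2
  by (meson continuous_at_imp_continuous_on has_vector_derivative_continuous)+

lemma curve_nonexpansive: "norm (z u - z v) \<le> \<bar>u - v\<bar>"
proof -
  have "norm (z u - z v) \<le> 1 * norm (u - v)"
  proof (rule differentiable_bound[of UNIV])
    show "(z has_derivative (\<lambda>h. h *\<^sub>R z' x)) (at x within UNIV)" for x
      using z_deriv by (simp add: has_vector_derivative_def)
    show "onorm (\<lambda>h. h *\<^sub>R z' x) \<le> 1" for x
      by (rule onorm_le) (simp add: z_unit_speed)
  qed auto
  then show ?thesis by simp
qed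

text \<open>The linear functional \<open>k \<mapsto> m \<bullet> k\<close> is maximal over \<open>K\<close> at \<open>z s\<close>, hence stationary along
  the curve, so \<open>m\<close> is orthogonal to the tangent. The orientation of the curve selects one
  of the two normal directions.\<close>

lemma outward_normal_direction:
  assumes m: "\<And>k. k \<in> K \<Longrightarrow> m \<bullet> (k - z s) \<le> 0"
  shows "m = norm m *\<^sub>R (- \<i> * z' s)"
proof -
  have "((\<lambda>u. m \<bullet> (z u - z s)) has_derivative (\<lambda>h. m \<bullet> (h *\<^sub>R z' s))) (at s)"
    using z_deriv[of s] unfolding has_vector_derivative_def
    by (auto intro!: derivative_eq_intros)
  then have "(\<lambda>h. m \<bullet> (h *\<^sub>R z' s)) = (\<lambda>h. 0)"
    by (rule differential_zero_maxmin[of s UNIV, rotated 2]) (use m curve_in_body in auto)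
  from fun_cong[OF this, of 1] have tang: "m \<bullet> z' s = 0"
    by simp
  have "\<exists>h>0. z s + h *\<^sub>R (\<i> * z' s) \<in> K"
    using eventually_happens[OF eventually_conj[OF z_ccw[of s] eventually_at_right_less[of 0]]]
    by auto
  then obtain h where "h > 0" "z s + h *\<^sub>R (\<i> * z' s) \<in> K"
    by blast
  with m[of "z s + h *\<^sub>R (\<i> * z' s)"] have le: "m \<bullet> (\<i> * z' s) \<le> 0"
    by (simp add: mult_le_0_iff)
  have eq: "m = (m \<bullet> (\<i> * z' s)) *\<^sub>R (\<i> * z' s)"
    using complex_unit_frame[OF z_unit_speed, of m s] tang by simp
  from arg_cong[OF eq, of norm] have "norm m = - (m \<bullet> (\<i> * z' s))"
    using le by (simp add: norm_mult z_unit_speed)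
  with eq show ?thesis
    by simp
qed

text \<open>Some supporting half plane exists at the frontier point \<open>z s\<close>, and by the previous lemma
  its boundary can only be the tangent line.\<close>

lemma body_in_left_half_plane:
  assumes "k \<in> K"
  shows "0 \<le> (k - z s) \<bullet> (\<i> * z' s)"
proof -
  have "z s \<in> frontier K"
    using z_boundary by blast
  then have "z s \<in> closure K" "z s \<notin> rel_interior K"
    using rel_interior_nonempty_interior[OF K_body] by (auto simp: frontier_def)
  then obtain a where a: "a \<noteq> 0" "\<And>y. y \<in> closure K \<Longrightarrow> a \<bullet> z s \<le> a \<bullet> y"
    using supporting_hyperplane_relative_frontier[OF K_convex] by metis
  have "- a = norm (- a) *\<^sub>R (- \<i> * z' s)"
    by (rule outward_normal_direction)
       (use a(2) closure_subset in \<open>force simp: inner_diff_right\<close>)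
  from arg_cong[OF this, of uminus] have "a = norm a *\<^sub>R (\<i> * z' s)"
    by simp
  moreover have "0 \<le> a \<bullet> (k - z s)"
    using a(2)[of k] assms closure_subset by (auto simp: inner_diff_right)
  ultimately have "0 \<le> norm a * ((\<i> * z' s) \<bullet> (k - z s))"
    by (metis inner_scaleR_left)
  with a(1) show ?thesis
    by (simp add: zero_le_mult_iff inner_commute)
qed

text \<open>A point on the outer normal ray at \<open>z s\<close> sees all of \<open>K\<close> beyond the tangent line
  at \<open>z s\<close>, hence at an obtuse or right angle there. This turns the search for the projection
  into a scalar equation for the parameter.\<close>

lemma closest_point_eqI:
  assumes tang: "(x - z s) \<bullet> z' s = 0" and norml: "(x - z s) \<bullet> (\<i> * z' s) \<le> 0"
  shows "closest_point K x = z s"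
proof (rule closest_point_unique[OF K_convex K_closed curve_in_body, symmetric], rule ballI)
  fix k assume "k \<in> K"
  have "x - z s = ((x - z s) \<bullet> (\<i> * z' s)) *\<^sub>R (\<i> * z' s)"
    using complex_unit_frame[OF z_unit_speed, of "x - z s" s] tang by simp
  then have "(x - z s) \<bullet> (k - z s) = ((x - z s) \<bullet> (\<i> * z' s)) * ((k - z s) \<bullet> (\<i> * z' s))"
    by (metis inner_scaleR_left inner_commute)
  also have "\<dots> \<le> 0"
    using norml body_in_left_half_plane[OF \<open>k \<in> K\<close>] by (rule mult_nonpos_nonneg)
  finally have "(x - z s) \<bullet> (k - z s) \<le> 0" .
  moreover have "(norm (x - k))\<^sup>2 = (norm (x - z s))\<^sup>2 - 2 * ((x - z s) \<bullet> (k - z s)) + (norm (k - z s))\<^sup>2"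
    unfolding power2_norm_eq_inner by (simp add: inner_diff_left inner_diff_right inner_commute)
  ultimately have "(norm (x - z s))\<^sup>2 \<le> (norm (x - k))\<^sup>2"
    using zero_le_power2[of "norm (k - z s)"] by linarith
  then show "dist x (z s) \<le> dist x k"
    by (simp add: dist_norm)
qed

lemma closest_point_on_curve:
  assumes "x \<notin> K"
  shows "\<exists>s. z s = closest_point K x"
proof -
  have "closest_point K x \<in> rel_frontier K"
  proof (rule closest_point_in_rel_frontier[OF K_closed body_nonempty])
    show "x \<in> affine hull K - rel_interior K"
      using assms rel_interior_subset affine_hull_nonempty_interior[OF K_body] by blast
  qed
  then have "closest_point K x \<in> frontier K"
    using rel_frontier_nonempty_interior[OF K_body] by simp
  then show ?thesis
    using z_boundary by (metis rangeE)
qed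

text \<open>The converse of the criterion above: the variational inequality for the
  projection says that \<open>x - z s\<close> is an outer normal, and its length is the distance to \<open>K\<close>.\<close>

lemma offset_from_closest_point:
  assumes "z s = closest_point K x"
  shows "x - z s = infdist x K *\<^sub>R (- \<i> * z' s)"
proof -
  have "norm (x - z s) = infdist x K"
    using setdist_closest_point[OF K_closed body_nonempty, of x] assms
    by (simp add: infdist_eq_setdist dist_norm)
  moreover have "x - z s = norm (x - z s) *\<^sub>R (- \<i> * z' s)"
    by (rule outward_normal_direction) (use closest_point_dot[OF K_convex K_closed] assms in simp)
  ultimately show ?thesis
    by simp
qed

text \<open>Constant speed makes \<open>z''\<close> orthogonal to \<open>z'\<close>. Its sign comes from a monotonicity
  argument: each of \<open>z s\<close>, \<open>z (s + h)\<close> lies to the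
  left of the tangent at the other, and adding the two inequalities compares the increments
  of \<open>z\<close> and \<open>z'\<close>.\<close>

lemma curvature_vector: "z'' s = norm (z'' s) *\<^sub>R (\<i> * z' s)"
proof -
  have "((\<lambda>u. z' u \<bullet> z' u) has_derivative (\<lambda>h. z' s \<bullet> (h *\<^sub>R z'' s) + (h *\<^sub>R z'' s) \<bullet> z' s)) (at s)"
    using z_deriv2[of s] unfolding has_vector_derivative_def by (intro has_derivative_inner)
  then have "((\<lambda>u. 1::real) has_derivative (\<lambda>h. 2 * (h *\<^sub>R z'' s \<bullet> z' s))) (at s)"
    by (simp add: tangent_inner_self inner_commute)
  then have "(\<lambda>h. 2 * (h *\<^sub>R z'' s \<bullet> z' s)) = (\<lambda>h. 0)"
    using has_derivative_unique has_derivative_const by blast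
  from fun_cong[OF this, of 1] have tang: "z'' s \<bullet> z' s = 0"
    by simp
  let ?q = "\<lambda>f h. (f (s + h) - f s) /\<^sub>R h"
  have "((\<lambda>h. (\<i> * ?q z' h) \<bullet> ?q z h) \<longlongrightarrow> (\<i> * z'' s) \<bullet> z' s) (at 0)"
    by (intro tendsto_intros has_vector_derivative_quotient z_deriv z_deriv2)
  moreover have "(\<i> * ?q z' h) \<bullet> ?q z h \<le> 0" for h
  proof -
    have "0 \<le> (z (s + h) - z s) \<bullet> (\<i> * z' s)" "0 \<le> (z s - z (s + h)) \<bullet> (\<i> * z' (s + h))"
      by (intro body_in_left_half_plane curve_in_body)+
    then have "(\<i> * (z' (s + h) - z' s)) \<bullet> (z (s + h) - z s) \<le> 0"
      by (simp add: inner_complex_def algebra_simps)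
    \<comment> \<open>Both quotients carry a factor \<open>1 / h\<close>, so the sign of \<open>h\<close> is irrelevant.\<close>
    then have "inverse h * inverse h * ((\<i> * (z' (s + h) - z' s)) \<bullet> (z (s + h) - z s)) \<le> 0"
      by (intro mult_nonneg_nonpos) auto
    then show ?thesis
      by (simp add: mult.assoc)
  qed
  ultimately have "(\<i> * z'' s) \<bullet> z' s \<le> 0"
    by (intro tendsto_upperbound[where F = "at (0::real)"]) auto
  then have nonneg: "0 \<le> z'' s \<bullet> (\<i> * z' s)"
    by (simp add: inner_complex_def)
  have eq: "z'' s = (z'' s \<bullet> (\<i> * z' s)) *\<^sub>R (\<i> * z' s)"
    using complex_unit_frame[OF z_unit_speed, of "z'' s" s] tang by simp
  from arg_cong[OF eq, of norm] have "norm (z'' s) = z'' s \<bullet> (\<i> * z' s)"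
    using nonneg by (simp add: norm_mult z_unit_speed)
  with eq show ?thesis
    by simp
qed

section \<open>The projection of a moving point\<close>

text \<open>The signed speed, in the parameter of the curve, at which the nearest point starts moving
  from \<open>z s\<close> when the projected point \<open>x\<close> has velocity \<open>v\<close>.\<close>

definition projection_speed :: "complex \<Rightarrow> complex \<Rightarrow> real \<Rightarrow> real" where
  "projection_speed x v s = (v \<bullet> z' s) / (1 + infdist x K * norm (z'' s))"

text \<open>The factor \<open>1 + r |z''|\<close> of the result arises here: \<open>z'\<close> contributes the \<open>1\<close>,
  and \<open>(c 0 - z s) \<bullet> z''(s) = - r |z''(s)|\<close> because the offset and the curvature vector point
  in opposite directions. Written with \<open>projection_speed\<close>, the derivative
  shows its sign as a function of \<open>b\<close>.\<close>

lemma tangential_offset_derivative: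
  assumes c: "(c has_vector_derivative c') (at 0)" and s: "z s = closest_point K (c 0)"
  shows "((\<lambda>t. (c t - z (s + b * t)) \<bullet> z' (s + b * t)) has_real_derivative
           (projection_speed (c 0) c' s - b) * (1 + infdist (c 0) K * norm (z'' s))) (at 0)"
    (is "(?g has_real_derivative ?d) _")
proof -
  let ?r = "infdist (c 0) K"
  have lin: "((\<lambda>t. s + b * t) has_vector_derivative b) (at 0)"
    by (auto intro!: derivative_eq_intros)
  have "((\<lambda>t. z (s + b * t)) has_derivative (\<lambda>h. h *\<^sub>R b *\<^sub>R z' s)) (at 0)"
       "((\<lambda>t. z' (s + b * t)) has_derivative (\<lambda>h. h *\<^sub>R b *\<^sub>R z'' s)) (at 0)"
    using vector_diff_chain_at[OF lin, of z "z' s"] vector_diff_chain_at[OF lin, of z' "z'' s"]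
      z_deriv[of s] z_deriv2[of s]
    by (simp_all add: o_def has_vector_derivative_def)
  then have "(?g has_derivative
      (\<lambda>h. (c 0 - z (s + b * 0)) \<bullet> (h *\<^sub>R b *\<^sub>R z'' s)
         + (h *\<^sub>R c' - h *\<^sub>R b *\<^sub>R z' s) \<bullet> z' (s + b * 0))) (at 0)"
    using c unfolding has_vector_derivative_def
    by (intro has_derivative_inner has_derivative_diff)
  moreover have "(c 0 - z (s + b * 0)) \<bullet> (h *\<^sub>R b *\<^sub>R z'' s)
      + (h *\<^sub>R c' - h *\<^sub>R b *\<^sub>R z' s) \<bullet> z' (s + b * 0) = ?d * h" for h
  proof -
    have "(c 0 - z s) \<bullet> z'' s = - ?r * norm (z'' s) * ((\<i> * z' s) \<bullet> (\<i> * z' s))"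
      by (subst curvature_vector, subst offset_from_closest_point[OF s]) simp
    also have "(\<i> * z' s) \<bullet> (\<i> * z' s) = 1"
      by (simp add: dot_square_norm norm_mult z_unit_speed)
    finally have *: "(c 0 - z s) \<bullet> z'' s = - ?r * norm (z'' s)"
      by simp
    have "1 + ?r * norm (z'' s) \<noteq> 0"
      using infdist_nonneg[of "c 0" K] by (smt (verit) mult_nonneg_nonneg norm_ge_zero)
    then have "?d = c' \<bullet> z' s - b * (1 + ?r * norm (z'' s))"
      by (simp add: projection_speed_def left_diff_distrib)
    moreover have "(c 0 - z s) \<bullet> (h *\<^sub>R b *\<^sub>R z'' s) = - b * (?r * norm (z'' s)) * h"
      by (simp add: *)
    ultimately show ?thesis
      by (simp add: inner_diff_left[of "h *\<^sub>R c'"] tangent_inner_self algebra_simps del: inner_scaleR_right)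
  qed
  ultimately show ?thesis
    by (simp add: has_field_derivative_def)
qed

text \<open>A solution of the scalar equation lies on the normal line at \<open>z u\<close>; that it
  is on the outer side follows by continuity from the case \<open>t = 0\<close>, \<open>u = s\<close>, where the component
  along \<open>\<i> z'\<close> is minus the positive distance to \<open>K\<close>.\<close>

lemma normal_ray_persistence:
  assumes c: "isCont c 0" and out: "c 0 \<notin> K" and s: "z s = closest_point K (c 0)"
  obtains \<eta> where "0 < \<eta>"
    and "\<And>t u. \<bar>t\<bar> < \<eta> \<Longrightarrow> \<bar>u - s\<bar> < \<eta> \<Longrightarrow> (c t - z u) \<bullet> (\<i> * z' u) < 0"
proof -
  let ?f = "\<lambda>p. (c (fst p) - z (snd p)) \<bullet> (\<i> * z' (snd p))"
  have "(c 0 - z s) \<bullet> (\<i> * z' s) = - infdist (c 0) K * ((\<i> * z' s) \<bullet> (\<i> * z' s))"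
    by (subst offset_from_closest_point[OF s]) simp
  also have "\<dots> < 0"
    using infdist_pos_not_in_closed[OF K_closed body_nonempty out]
    by (simp add: dot_square_norm norm_mult z_unit_speed)
  finally have neg: "?f (0, s) < 0"
    by simp
  have "isCont z s" "isCont z' s"
    using z_deriv z_deriv2 has_vector_derivative_continuous by blast+
  then have "isCont ?f (0, s)"
    using c by (intro continuous_intros isCont_o2[where f = fst] isCont_o2[where f = snd]) simp_all
  then have "(?f \<longlongrightarrow> ?f (0, s)) (nhds (0, s))"
    by (simp only: isCont_def tendsto_at_iff_tendsto_nhds[of ?f])
  then have "\<forall>\<^sub>F p in nhds (0, s). ?f p < 0"
    using neg by (rule order_tendstoD(2))
  then obtain P Q where PQ: "eventually P (nhds 0)" "eventually Q (nhds s)"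
      "\<And>t u. P t \<Longrightarrow> Q u \<Longrightarrow> ?f (t, u) < 0"
    unfolding nhds_prod eventually_prod_filter by auto
  obtain d e where "d > 0" "e > 0" and d: "\<And>t. dist t 0 < d \<Longrightarrow> P t" and e: "\<And>u. dist u s < e \<Longrightarrow> Q u"
    using PQ(1,2) unfolding eventually_nhds_metric by blast
  show thesis
  proof
    show "0 < min d e"
      using \<open>d > 0\<close> \<open>e > 0\<close> by simp
    show "(c t - z u) \<bullet> (\<i> * z' u) < 0" if "\<bar>t\<bar> < min d e" "\<bar>u - s\<bar> < min d e" for t u
      using PQ(3)[OF d e, of t u] that by (simp add: dist_real_def)
  qed
qed

text \<open>The quantitative core. The solution of the scalar equation is trapped between the two
  parameters \<open>s + (a - \<epsilon>) t\<close> and \<open>s + (a + \<epsilon>) t\<close>, which determines its velocity without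
  first selecting a solution for each \<open>t\<close> and differentiating it.\<close>

lemma closest_point_tracks_curve:
  assumes c: "(c has_vector_derivative c') (at 0)" and out: "c 0 \<notin> K"
    and s: "z s = closest_point K (c 0)" and "0 < \<epsilon>"
  shows "\<forall>\<^sub>F t in at_right 0.
    norm (closest_point K (c t) - z (s + projection_speed (c 0) c' s * t)) \<le> \<epsilon> * t"
proof -
  define a where "a = projection_speed (c 0) c' s"
  define D where "D = 1 + infdist (c 0) K * norm (z'' s)"
  define g where "g b t = (c t - z (s + b * t)) \<bullet> z' (s + b * t)" for b t
  have "D > 0"
    unfolding D_def using infdist_nonneg[of "c 0" K] by (smt (verit) mult_nonneg_nonneg norm_ge_zero)
  have g: "(g b has_real_derivative (a - b) * D) (at 0)" for b
    unfolding g_def a_def D_def by (rule tangential_offset_derivative[OF c s])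
  have g0: "g b 0 = 0" for b
    using offset_from_closest_point[OF s] by (simp add: g_def inner_complex_def)
  obtain d1 where d1: "d1 > 0" "\<And>t. 0 < t \<Longrightarrow> t < d1 \<Longrightarrow> 0 < g (a - \<epsilon>) t"
    using DERIV_pos_inc_right[OF g[of "a - \<epsilon>"]] \<open>0 < \<epsilon>\<close> \<open>D > 0\<close> by (auto simp: g0)
  obtain d2 where d2: "d2 > 0" "\<And>t. 0 < t \<Longrightarrow> t < d2 \<Longrightarrow> g (a + \<epsilon>) t < 0"
    using DERIV_neg_dec_right[OF g[of "a + \<epsilon>"]] \<open>0 < \<epsilon>\<close> \<open>D > 0\<close> by (auto simp: g0 mult_less_0_iff)
  obtain \<eta> where \<eta>: "0 < \<eta>"
      "\<And>t u. \<bar>t\<bar> < \<eta> \<Longrightarrow> \<bar>u - s\<bar> < \<eta> \<Longrightarrow> (c t - z u) \<bullet> (\<i> * z' u) < 0"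
    using normal_ray_persistence[OF has_vector_derivative_continuous[OF c] out s] by metis
  \<comment> \<open>The trapped parameters satisfy \<open>|u - s| \<le> (|a| + \<epsilon>) t\<close>; the extra \<open>1\<close> in the
    denominator makes the same bound also cover \<open>t < \<eta>\<close>.\<close>
  define \<tau> where "\<tau> = min (min d1 d2) (\<eta> / (1 + \<bar>a\<bar> + \<epsilon>))"
  have "\<tau> > 0"
    using d1(1) d2(1) \<eta>(1) \<open>0 < \<epsilon>\<close> by (simp add: \<tau>_def add_pos_nonneg add_pos_pos)
  have "norm (closest_point K (c t) - z (s + a * t)) \<le> \<epsilon> * t" if t: "0 < t" "t < \<tau>" for t
  proof -
    have small: "(1 + \<bar>a\<bar> + \<epsilon>) * t < \<eta>"
      using t \<open>0 < \<epsilon>\<close> by (simp add: \<tau>_def pos_less_divide_eq mult.commute)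
    have "\<exists>u\<ge>s + (a - \<epsilon>) * t. u \<le> s + (a + \<epsilon>) * t \<and> (c t - z u) \<bullet> z' u = 0"
    proof (rule IVT2')
      show "(c t - z (s + (a + \<epsilon>) * t)) \<bullet> z' (s + (a + \<epsilon>) * t) \<le> 0"
        using d2(2)[of t] t by (simp add: g_def \<tau>_def)
      show "0 \<le> (c t - z (s + (a - \<epsilon>) * t)) \<bullet> z' (s + (a - \<epsilon>) * t)"
        using d1(2)[of t] t by (simp add: g_def \<tau>_def)
      show "s + (a - \<epsilon>) * t \<le> s + (a + \<epsilon>) * t"
        using t \<open>0 < \<epsilon>\<close> by (simp add: mult_right_mono)
    qed (intro continuous_intros continuous_on_curve)
    then obtain u where u: "s + (a - \<epsilon>) * t \<le> u" "u \<le> s + (a + \<epsilon>) * t" "(c t - z u) \<bullet> z' u = 0"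
      by blast
    have near: "\<bar>u - (s + a * t)\<bar> \<le> \<epsilon> * t"
      using u(1,2) by (simp add: abs_le_iff algebra_simps)
    have "\<bar>u - s\<bar> \<le> \<bar>a * t\<bar> + \<epsilon> * t"
      using near by linarith
    also have "\<dots> \<le> (1 + \<bar>a\<bar> + \<epsilon>) * t"
      using t by (simp add: abs_mult algebra_simps)
    also note small
    finally have "\<bar>u - s\<bar> < \<eta>" .
    moreover have "\<bar>t\<bar> < \<eta>"
    proof -
      have "t \<le> (1 + \<bar>a\<bar> + \<epsilon>) * t"
        using t \<open>0 < \<epsilon>\<close> by (simp add: algebra_simps)
      with small have "t < \<eta>"
        by linarith
      with t show ?thesis
        by simp
    qed
    ultimately have "closest_point K (c t) = z u"
      using \<eta>(2)[of t u] u(3) by (intro closest_point_eqI) auto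
    then show ?thesis
      using curve_nonexpansive[of u "s + a * t"] near by simp
  qed
  then show ?thesis
    using \<open>\<tau> > 0\<close> unfolding eventually_at_right_field a_def by auto
qed

lemma closest_point_right_derivative:
  assumes c: "(c has_vector_derivative c') (at 0)" and out: "c 0 \<notin> K"
    and s: "z s = closest_point K (c 0)"
  shows "((\<lambda>t. (closest_point K (c t) - closest_point K (c 0)) /\<^sub>R t) \<longlongrightarrow>
           projection_speed (c 0) c' s *\<^sub>R z' s) (at_right 0)"
proof -
  define a where "a = projection_speed (c 0) c' s"
  have lin: "((\<lambda>t. s + a * t) has_vector_derivative a) (at 0)"
    by (auto intro!: derivative_eq_intros)
  have "((\<lambda>t. z (s + a * t)) has_vector_derivative a *\<^sub>R z' s) (at 0)"
    using vector_diff_chain_at[OF lin, of z "z' s"] z_deriv[of s] by (simp add: o_def)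
  from has_vector_derivative_quotient[OF this]
  have curve: "((\<lambda>t. (z (s + a * t) - z s) /\<^sub>R t) \<longlongrightarrow> a *\<^sub>R z' s) (at_right 0)"
    by (auto intro: tendsto_mono[OF at_le])
  have "((\<lambda>t. (closest_point K (c t) - z (s + a * t)) /\<^sub>R t) \<longlongrightarrow> 0) (at_right 0)"
  proof (rule tendstoI)
    fix e :: real assume "0 < e"
    have "\<forall>\<^sub>F t in at_right 0. norm (closest_point K (c t) - z (s + a * t)) \<le> e / 2 * t"
      unfolding a_def by (rule closest_point_tracks_curve[OF c out s]) (use \<open>0 < e\<close> in simp)
    then show "\<forall>\<^sub>F t in at_right 0. dist ((closest_point K (c t) - z (s + a * t)) /\<^sub>R t) 0 < e"
      using eventually_at_right_less[of 0]
    proof eventually_elim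
      case (elim t)
      then have "norm (closest_point K (c t) - z (s + a * t)) / t \<le> e / 2"
        by (simp add: pos_divide_le_eq)
      moreover have "dist ((closest_point K (c t) - z (s + a * t)) /\<^sub>R t) 0
          = norm (closest_point K (c t) - z (s + a * t)) / t"
        using elim(2) by (simp add: divide_inverse_commute)
      ultimately show ?case
        using \<open>0 < e\<close> by linarith
    qed
  qed
  from tendsto_add[OF this curve] show ?thesis
    by (simp add: s[symmetric] a_def scaleR_diff_right)
qed

end

theorem lemma2:
  fixes K :: "complex set"
    and z z' z'' :: "real \<Rightarrow> complex"
    and c :: "real \<Rightarrow> complex"
    and c' :: complex
    and \<delta> :: real
  assumes K_closed: "closed K"
    and K_convex: "convex K"
    and K_body: "interior K \<noteq> {}"
    and z_boundary: "range z = frontier K"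
    and z_deriv: "\<And>s. (z has_vector_derivative z' s) (at s)"
    and z_deriv2: "\<And>s. (z' has_vector_derivative z'' s) (at s)"
    and z_unit_speed: "\<And>s. norm (z' s) = 1"
    and z_ccw: "\<And>s. \<forall>\<^sub>F h in at_right 0. z s + h *\<^sub>R (\<i> * z' s) \<in> K"
    and \<delta>_pos: "0 < \<delta>"
    and c_smooth: "smooth_on {-\<delta><..<\<delta>} c"
    and c_outside: "\<And>t. t \<in> {-\<delta><..<\<delta>} \<Longrightarrow> c t \<notin> K"
    and c_deriv: "(c has_vector_derivative c') (at 0)"
  shows "0 < infdist (c 0) K \<and>
    (\<exists>s\<^sub>0. z s\<^sub>0 = closest_point K (c 0)) \<and>
    (\<exists>P. ((\<lambda>t. (closest_point K (c t) - closest_point K (c 0)) /\<^sub>R t) \<longlongrightarrow> P) (at_right 0) \<and>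
         (\<forall>s\<^sub>0. z s\<^sub>0 = closest_point K (c 0) \<longrightarrow>
            norm P = norm (orth_proj (span {z' s\<^sub>0}) c')
                       / (1 + infdist (c 0) K * norm (z'' s\<^sub>0))))"
proof -
  interpret convex_body_boundary_curve K z z' z''
    using K_closed K_convex K_body z_boundary z_deriv z_deriv2 z_unit_speed z_ccw
    by unfold_locales
  have out: "c 0 \<notin> K"
    using c_outside \<delta>_pos by simp
  obtain s where s: "z s = closest_point K (c 0)"
    using closest_point_on_curve[OF out] by blast
  define P where "P = projection_speed (c 0) c' s *\<^sub>R z' s"
  have lim: "((\<lambda>t. (closest_point K (c t) - closest_point K (c 0)) /\<^sub>R t) \<longlongrightarrow> P) (at_right 0)"
    unfolding P_def by (rule closest_point_right_derivative[OF c_deriv out s])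
  have "norm P = norm (orth_proj (span {z' u}) c') / (1 + infdist (c 0) K * norm (z'' u))"
    if u: "z u = closest_point K (c 0)" for u
  proof -
    \<comment> \<open>The curve may pass through the foot point at several parameters, for example when it is
      closed; uniqueness of the limit makes them all give the same velocity.\<close>
    have "P = projection_speed (c 0) c' u *\<^sub>R z' u"
      using tendsto_unique[OF _ lim closest_point_right_derivative[OF c_deriv out u]] by simp
    then show ?thesis
      by (simp add: projection_speed_def orth_proj_span_singleton tangent_inner_self
          z_unit_speed infdist_nonneg abs_divide add_nonneg_nonneg)
  qed
  then show ?thesis
    using infdist_pos_not_in_closed[OF K_closed body_nonempty out] s lim by blast
qed

end
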